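(* Let $m$ be a non-negative integer. For $z\in\mathbb{C}$ with $|z|<1$, $$T_m^2(1-2z)=F^2\left(-m,m;\tfrac12;z\right)=\sum_{n=0}^\infty u_n z^n,$$ where $u_0=1$, $u_1=-4m^2$ and $$u_{n+1}=\frac{-8m^2+4n^2-3n+1}{(2n+1)(n+1)}u_n-\frac{2(n-1)(-2m+n-1)(2m+n-1)}{n(n+1)(2n+1)}u_{n-1},\qquad n\ge 1.$$
   Context: $T_m$ is the Chebyshev polynomial of the first kind ($T_m(\cos\theta)=\cos m\theta$). $F(a,b;c;z)=\sum_{k=0}^\infty \frac{(a)_k(b)_k}{(c)_k\,k!}z^k$, $|z|<1$, is the Gaussian hypergeometric function, with $(x)_k=x(x+1)\cdots(x+k-1)$, $(x)_0=1$. Superscript $2$ on a function denotes its square. *)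

theory Defs
  imports "HOL-Analysis.Analysis"
begin

text \<open>
  The Chebyshev polynomial of the first kind is the unique polynomial satisfying
  \<open>T\<^sub>m(cos \<theta>) = cos (m\<theta>)\<close> for real \<open>\<theta>\<close>; existence and uniqueness are shown below, so the
  description operator is well-behaved.
\<close>

definition chebyshev_T :: "nat \<Rightarrow> complex poly" where
  "chebyshev_T m = (THE p. \<forall>\<theta>::real. poly p (of_real (cos \<theta>)) = of_real (cos (of_nat m * \<theta>)))"

lemma ex1_chebyshev_T:
  "\<exists>!p :: complex poly. \<forall>\<theta>::real. poly p (of_real (cos \<theta>)) = of_real (cos (of_nat m * \<theta>))"
proof (rule ex_ex1I)
  show "\<exists>p :: complex poly. \<forall>\<theta>::real. poly p (of_real (cos \<theta>)) = of_real (cos (of_nat m * \<theta>))"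
  proof (induction m rule: less_induct)
    case (less m)
    consider "m = 0" | "m = 1" | n where "m = Suc (Suc n)"
      by (metis One_nat_def not0_implies_Suc)
    then show ?case
    proof cases
      case 1
      then show ?thesis by (intro exI[of _ 1]) simp
    next
      case 2
      then show ?thesis by (intro exI[of _ "[:0, 1:]"]) simp
    next
      case (3 n)
      obtain p :: "complex poly"
        where p: "\<And>\<theta>::real. poly p (of_real (cos \<theta>)) = of_real (cos (of_nat n * \<theta>))"
        using less.IH[of n] 3 by auto
      obtain q :: "complex poly"
        where q: "\<And>\<theta>::real. poly q (of_real (cos \<theta>)) = of_real (cos (of_nat (Suc n) * \<theta>))"
        using less.IH[of "Suc n"] 3 by blast
      have "cos (of_nat m * \<theta>) = 2 * cos \<theta> * cos (of_nat (Suc n) * \<theta>) - cos (of_nat n * \<theta>)"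
        for \<theta> :: real
      proof -
        have *: "of_nat m * \<theta> = of_nat (Suc n) * \<theta> + \<theta>" "of_nat n * \<theta> = of_nat (Suc n) * \<theta> - \<theta>"
          using 3 by (simp_all add: algebra_simps)
        show ?thesis
          unfolding * cos_add cos_diff by simp
      qed
      then show ?thesis
        by (intro exI[of _ "[:0, 2:] * q - p"]) (simp add: p q del: of_nat_Suc)
    qed
  qed
next
  fix p q :: "complex poly"
  assume p: "\<forall>\<theta>::real. poly p (of_real (cos \<theta>)) = of_real (cos (of_nat m * \<theta>))"
    and q: "\<forall>\<theta>::real. poly q (of_real (cos \<theta>)) = of_real (cos (of_nat m * \<theta>))"
  have "of_real ` {-1..1::real} \<subseteq> {x. poly (p - q) x = 0}"
  proof safe
    fix x :: real assume "x \<in> {-1..1}"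
    then have "x = cos (arccos x)" by simp
    then show "poly (p - q) (complex_of_real x) = 0"
      using p q by (metis diff_self poly_diff)
  qed
  moreover have "infinite (complex_of_real ` {-1..1::real})"
    by (subst finite_image_iff) (auto simp: inj_on_def)
  ultimately have "infinite {x. poly (p - q) x = 0}"
    by (meson finite_subset)
  then show "p = q"
    using poly_roots_finite[of "p - q"] by auto
qed

lemma poly_chebyshev_T_cos:
  "poly (chebyshev_T m) (of_real (cos \<theta>)) = of_real (cos (of_nat m * \<theta>))"
  using theI'[OF ex1_chebyshev_T[of m]] unfolding chebyshev_T_def by blast

text \<open>Only meant for \<open>|z| < 1\<close> and \<open>c\<close> not a non-positive integer.\<close>

definition hypergeo_2F1 :: "complex \<Rightarrow> complex \<Rightarrow> complex \<Rightarrow> complex \<Rightarrow> complex" where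
  "hypergeo_2F1 a b c z =
     (\<Sum>k. pochhammer a k * pochhammer b k / (pochhammer c k * fact k) * z ^ k)"

end

theory Submission
  imports Defs
begin

text \<open>
  The double angle formula gives \<open>T\<^sub>m\<^sup>2 = (1 + T\<^sub>2\<^sub>m) / 2\<close>, so squaring the series of
  \<open>T\<^sub>m(1 - 2 z)\<close> requires no Cauchy product: away from the constant term, the coefficients of
  the square are half of those of \<open>T\<^sub>2\<^sub>m(1 - 2 z) = F(-2 m, 2 m; 1/2; z)\<close>.

  The identity \<open>T\<^sub>m(1 - 2 z) = F(-m, m; 1/2; z)\<close> follows by induction on \<open>m\<close>: the three-term
  recurrence of \<open>T\<^sub>m\<close>, read off coefficientwise at \<open>x = 1 - 2 z\<close>, is a contiguous relation
  between the hypergeometric coefficients (lemma \<open>gauss_coeff_contiguous\<close>).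

  It remains to see that the second-order recurrence produces these coefficients. The
  hypergeometric coefficients obey a first-order recurrence, and for \<open>n \<ge> 1\<close> the sequence \<open>u\<close> is
  forced to obey the same one (lemma \<open>first_order_recurrence\<close>): in the second-order recurrence,
  the term in \<open>u\<^sub>n\<^sub>-\<^sub>1\<close> is, by the first-order relation between \<open>u\<^sub>n\<^sub>-\<^sub>1\<close> and \<open>u\<^sub>n\<close>, a multiple of
  \<open>u\<^sub>n\<close>. Its factor \<open>n - 1\<close> accommodates the exceptional constant term, because it removes \<open>u\<^sub>0\<close>
  from the recurrence at \<open>n = 1\<close>.
\<close>

definition gauss_coeff :: "complex \<Rightarrow> nat \<Rightarrow> complex" where
  "gauss_coeff a k =
     pochhammer (- a) k * pochhammer a k / (pochhammer (1 / 2) k * fact k)"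

lemma gauss_coeff_0 [simp]: "gauss_coeff a 0 = 1"
  by (simp add: gauss_coeff_def)

lemma two_of_nat_plus_1_neq_0: "2 * of_nat k + 1 \<noteq> (0 :: complex)"
proof -
  have "of_nat (2 * k + 1) \<noteq> (0 :: complex)"
    unfolding of_nat_eq_0_iff by simp
  then show ?thesis by (simp add: add.commute)
qed

lemma gauss_coeff_Suc:
  "gauss_coeff a (Suc k) =
     2 * (of_nat k ^ 2 - a ^ 2) / ((2 * of_nat k + 1) * (of_nat k + 1)) * gauss_coeff a k"
proof -
  have half: "1 / 2 + of_nat k = (2 * of_nat k + 1) / (2 :: complex)"
    by (simp add: field_simps)
  have "gauss_coeff a (Suc k) =
      (of_nat k - a) * (of_nat k + a) / ((1 / 2 + of_nat k) * (of_nat k + 1)) * gauss_coeff a k"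
    by (simp add: gauss_coeff_def pochhammer_Suc mult_ac add_ac)
  also have "\<dots> =
      2 * (of_nat k ^ 2 - a ^ 2) / ((2 * of_nat k + 1) * (of_nat k + 1)) * gauss_coeff a k"
    unfolding half by (simp add: power2_eq_square algebra_simps)
  finally show ?thesis .
qed

text \<open>
  The three shifted products share the factor \<open>(1 - a)\<^sub>k\<^sub>-\<^sub>1 (1 + a)\<^sub>k\<^sub>-\<^sub>1\<close> (for \<open>k \<ge> 1\<close>), whose
  cofactors are polynomials of degree four in \<open>a\<close> and \<open>k\<close>. Splitting this factor off, instead of
  dividing by linear terms, keeps the argument valid where the products vanish.
\<close>
lemma pochhammer_second_difference:
  fixes a :: complex
  shows "pochhammer (- (a + 1)) (Suc k) * pochhammer (a + 1) (Suc k)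
       + pochhammer (- (a - 1)) (Suc k) * pochhammer (a - 1) (Suc k)
       - 2 * (pochhammer (- a) (Suc k) * pochhammer a (Suc k))
     = - 2 * (2 * of_nat k + 1) * (of_nat k + 1) * (pochhammer (- a) k * pochhammer a k)"
proof (cases k)
  case 0
  then show ?thesis by (simp add: algebra_simps)
next
  case (Suc j)
  have up: "pochhammer (b + 1) (Suc (Suc j))
      = pochhammer (b + 1) j * (b + of_nat j + 1) * (b + of_nat j + 2)" for b :: complex
    by (simp add: pochhammer_Suc algebra_simps)
  have mid: "pochhammer b (Suc (Suc j)) = b * pochhammer (b + 1) j * (b + of_nat j + 1)"
    for b :: complex
    unfolding pochhammer_rec[of b] pochhammer_Suc[of "b + 1"] by (simp add: algebra_simps)
  have down: "pochhammer (b - 1) (Suc (Suc j)) = (b - 1) * b * pochhammer (b + 1) j"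
    for b :: complex
    by (simp add: pochhammer_rec)
  have minus: "- (a + 1) = (- a) - 1" "- (a - 1) = (- a) + 1"
    by simp_all
  show ?thesis
    unfolding Suc minus up[of a] up[of "- a"] mid[of a] mid[of "- a"] down[of a] down[of "- a"]
      pochhammer_rec[of a j] pochhammer_rec[of "- a" j]
    by (simp add: algebra_simps power2_eq_square)
qed

text \<open>
  For natural \<open>a = n\<close> this is the coefficientwise form of \<open>T\<^sub>n\<^sub>+\<^sub>1(x) = 2 x T\<^sub>n(x) - T\<^sub>n\<^sub>-\<^sub>1(x)\<close>
  at \<open>x = 1 - 2 z\<close>.
\<close>
lemma gauss_coeff_contiguous:
  "gauss_coeff (a + 1) (Suc k) =
     2 * gauss_coeff a (Suc k) - 4 * gauss_coeff a k - gauss_coeff (a - 1) (Suc k)"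
proof -
  define d :: complex where "d = pochhammer (1 / 2) k * fact k"
  define e :: complex where "e = pochhammer (1 / 2) (Suc k) * fact (Suc k)"
  have e: "2 * e = (2 * of_nat k + 1) * (of_nat k + 1) * d"
    by (simp add: d_def e_def pochhammer_Suc field_simps)
  have "2 * gauss_coeff a (Suc k) - gauss_coeff (a - 1) (Suc k) - gauss_coeff (a + 1) (Suc k)
      = - (pochhammer (- (a + 1)) (Suc k) * pochhammer (a + 1) (Suc k)
         + pochhammer (- (a - 1)) (Suc k) * pochhammer (a - 1) (Suc k)
         - 2 * (pochhammer (- a) (Suc k) * pochhammer a (Suc k))) / e"
    unfolding gauss_coeff_def e_def[symmetric]
    by (simp only: add_divide_distrib diff_divide_distrib minus_divide_left[symmetric]
        times_divide_eq_right) simp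
  also have "\<dots> = 4 * ((2 * of_nat k + 1) * (of_nat k + 1))
      * (pochhammer (- a) k * pochhammer a k) / (2 * e)"
    unfolding pochhammer_second_difference by (simp add: divide_simps) (simp add: algebra_simps)
  also have "\<dots> = 4 * gauss_coeff a k"
    using two_of_nat_plus_1_neq_0[of k] of_nat_neq_0[of k, where 'a = complex]
    unfolding e by (simp add: gauss_coeff_def d_def add_ac)
  finally show ?thesis by (simp add: algebra_simps)
qed

lemma chebyshev_T_unique:
  assumes "\<And>\<theta>::real. poly p (of_real (cos \<theta>)) = of_real (cos (of_nat m * \<theta>))"
  shows "chebyshev_T m = p"
  using ex1_chebyshev_T[of m] poly_chebyshev_T_cos[of m] assms by blast

lemma chebyshev_T_0: "chebyshev_T 0 = 1"
  by (rule chebyshev_T_unique) simp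

lemma chebyshev_T_1: "chebyshev_T (Suc 0) = [:0, 1:]"
  by (rule chebyshev_T_unique) simp

lemma chebyshev_T_Suc_Suc:
  "chebyshev_T (Suc (Suc n)) = [:0, 2:] * chebyshev_T (Suc n) - chebyshev_T n"
proof (rule chebyshev_T_unique)
  fix \<theta> :: real
  have *: "of_nat (Suc (Suc n)) * \<theta> = of_nat (Suc n) * \<theta> + \<theta>"
    "of_nat n * \<theta> = of_nat (Suc n) * \<theta> - \<theta>"
    by (simp_all add: algebra_simps)
  have "cos (of_nat (Suc (Suc n)) * \<theta>)
      = 2 * cos \<theta> * cos (of_nat (Suc n) * \<theta>) - cos (of_nat n * \<theta>)"
    unfolding * cos_add cos_diff by simp
  then show "poly ([:0, 2:] * chebyshev_T (Suc n) - chebyshev_T n) (of_real (cos \<theta>))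
      = of_real (cos (of_nat (Suc (Suc n)) * \<theta>))"
    by (simp add: poly_chebyshev_T_cos del: of_nat_Suc)
qed

lemma chebyshev_T_double: "chebyshev_T (2 * m) = 2 * chebyshev_T m ^ 2 - 1"
proof (rule chebyshev_T_unique)
  fix \<theta> :: real
  have "cos (of_nat (2 * m) * \<theta>) = 2 * cos (of_nat m * \<theta>) ^ 2 - 1"
    using cos_double_cos[of "of_nat m * \<theta>"] by (simp add: mult_ac)
  then show "poly (2 * chebyshev_T m ^ 2 - 1) (of_real (cos \<theta>))
      = of_real (cos (of_nat (2 * m) * \<theta>))"
    by (simp add: poly_chebyshev_T_cos del: of_nat_mult)
qed

text \<open>
  The recurrence of \<open>T\<^sub>n\<close> is transferred to the series term by term: multiplication by \<open>z\<close> is an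
  index shift, so the coefficients obey \<open>gauss_coeff_contiguous\<close>. The series terminates, hence
  the identity holds on the whole plane.
\<close>
lemma gauss_coeff_sums_chebyshev_T:
  "(\<lambda>k. gauss_coeff (of_nat n) k * z ^ k) sums poly (chebyshev_T n) (1 - 2 * z)"
proof (induction n rule: induct_nat_012)
  case 0
  have "gauss_coeff 0 k * z ^ k = (if k = 0 then 1 else 0)" for k
    by (cases k) (simp_all add: gauss_coeff_def pochhammer_rec)
  then show ?case
    using sums_single[of 0 "\<lambda>_. 1 :: complex"] by (simp only: chebyshev_T_0 poly_1 of_nat_0)
next
  case 1
  have vanish: "gauss_coeff 1 (Suc (Suc k)) = 0" for k
  proof (induction k)
    case 0
    then show ?case by (simp add: gauss_coeff_Suc[of _ "Suc 0"])
  next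
    case (Suc k)
    then show ?case by (subst gauss_coeff_Suc) simp
  qed
  have "(\<lambda>k. gauss_coeff 1 k * z ^ k) sums (\<Sum>k\<in>{0, Suc 0}. gauss_coeff 1 k * z ^ k)"
  proof (rule sums_finite)
    fix k assume "k \<notin> {0, Suc 0}"
    then obtain j where "k = Suc (Suc j)"
      by (metis insertI1 insertI2 not0_implies_Suc)
    then show "gauss_coeff 1 k * z ^ k = 0"
      by (simp add: vanish)
  qed simp
  then show ?case
    by (simp add: chebyshev_T_1 gauss_coeff_Suc)
next
  case (ge2 n)
  let ?f = "\<lambda>n k. gauss_coeff (of_nat n) k * z ^ k"
  let ?P = "\<lambda>n. poly (chebyshev_T n) (1 - 2 * z)"
  have tail: "(\<lambda>k. ?f j (Suc k)) sums (?P j - 1)" if "?f j sums ?P j" for j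
    using that by (subst sums_Suc_iff) simp
  have "(\<lambda>k. 2 * ?f (Suc n) (Suc k) - 4 * z * ?f (Suc n) k - ?f n (Suc k))
      sums (2 * (?P (Suc n) - 1) - 4 * z * ?P (Suc n) - (?P n - 1))"
    by (intro sums_diff sums_mult tail ge2.IH)
  moreover have "2 * ?f (Suc n) (Suc k) - 4 * z * ?f (Suc n) k - ?f n (Suc k)
      = ?f (Suc (Suc n)) (Suc k)" for k
  proof -
    have "gauss_coeff (of_nat (Suc (Suc n))) (Suc k) =
        2 * gauss_coeff (of_nat (Suc n)) (Suc k) - 4 * gauss_coeff (of_nat (Suc n)) k
        - gauss_coeff (of_nat n) (Suc k)"
      using gauss_coeff_contiguous[of "of_nat (Suc n)" k] by (simp add: add_ac)
    then show ?thesis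
      by (simp only: power_Suc) (simp add: algebra_simps)
  qed
  moreover have "2 * (?P (Suc n) - 1) - 4 * z * ?P (Suc n) - (?P n - 1)
      = ?P (Suc (Suc n)) - 1"
    by (simp add: chebyshev_T_Suc_Suc algebra_simps)
  ultimately have "(\<lambda>k. ?f (Suc (Suc n)) (Suc k)) sums (?P (Suc (Suc n)) - 1)"
    by (simp del: of_nat_Suc power_Suc)
  then show ?case
    by (subst (asm) sums_Suc_iff) simp
qed

lemma hypergeo_2F1_eq_chebyshev_T:
  "hypergeo_2F1 (- of_nat m) (of_nat m) (1 / 2) z = poly (chebyshev_T m) (1 - 2 * z)"
  using sums_unique[OF gauss_coeff_sums_chebyshev_T[of m z]]
  by (simp add: hypergeo_2F1_def gauss_coeff_def)

text \<open>
  The first-order relation is established from index one on, where the factor \<open>n - 1\<close> removes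
  \<open>u 0\<close>. At index zero it would demand \<open>u 1 = - 2 * b\<^sup>2 * u 0\<close>, which the coefficient sequence
  of \<open>T\<^sub>m(1 - 2 z)\<^sup>2\<close> violates for \<open>b = 2 m > 0\<close>: there \<open>u 0 = 1\<close> and \<open>u 1 = - b\<^sup>2\<close>.
\<close>
lemma first_order_recurrence:
  fixes u :: "nat \<Rightarrow> complex" and b :: complex
  assumes u_rec: "\<And>n. n \<ge> 1 \<Longrightarrow>
      u (n + 1) =
        (- 2 * b ^ 2 + 4 * of_nat n ^ 2 - 3 * of_nat n + 1)
          / ((2 * of_nat n + 1) * (of_nat n + 1)) * u n
        - 2 * (of_nat n - 1) * (- b + of_nat n - 1) * (b + of_nat n - 1)
          / (of_nat n * (of_nat n + 1) * (2 * of_nat n + 1)) * u (n - 1)"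
    and "n \<ge> 1"
  shows "u (Suc n) = 2 * (of_nat n ^ 2 - b ^ 2) / ((2 * of_nat n + 1) * (of_nat n + 1)) * u n"
  using \<open>n \<ge> 1\<close>
proof (induction n rule: dec_induct)
  case base
  show ?case
    using u_rec[of 1] by simp
next
  case (step n)
  define N :: complex where "N = of_nat (Suc n)"
  have N: "N \<noteq> 0" "N + 1 \<noteq> 0" "2 * N + 1 \<noteq> 0" "2 * N - 1 \<noteq> 0"
    unfolding N_def
    using two_of_nat_plus_1_neq_0[of "Suc n"] two_of_nat_plus_1_neq_0[of n]
      of_nat_neq_0[of n, where 'a = complex] of_nat_neq_0[of "Suc n", where 'a = complex]
    by (simp_all add: algebra_simps)
  have "u (Suc n) = 2 * ((N - 1) ^ 2 - b ^ 2) / ((2 * N - 1) * N) * u n"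
    using step.IH by (simp add: N_def algebra_simps)
  then have "u (Suc n) * ((2 * N - 1) * N) = 2 * ((N - 1) ^ 2 - b ^ 2) * u n"
    using N by simp
  then have remainder: "2 * (N - 1) * (- b + N - 1) * (b + N - 1) * u n
      = (N - 1) * (2 * N - 1) * u (Suc n) * N"
    by algebra
  have "u (Suc (Suc n)) =
      (- 2 * b ^ 2 + 4 * N ^ 2 - 3 * N + 1) / ((2 * N + 1) * (N + 1)) * u (Suc n)
      - (2 * (N - 1) * (- b + N - 1) * (b + N - 1) * u n) / (N * (N + 1) * (2 * N + 1))"
    using u_rec[of "Suc n"] by (simp add: N_def)
  also have "\<dots> =
      ((- 2 * b ^ 2 + 4 * N ^ 2 - 3 * N + 1) * u (Suc n) - (N - 1) * (2 * N - 1) * u (Suc n))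
        / ((2 * N + 1) * (N + 1))"
    unfolding remainder using N by (simp add: diff_divide_distrib mult_ac)
  also have "(- 2 * b ^ 2 + 4 * N ^ 2 - 3 * N + 1) * u (Suc n) - (N - 1) * (2 * N - 1) * u (Suc n)
      = 2 * (N ^ 2 - b ^ 2) * u (Suc n)"
    by algebra
  finally show ?case
    by (simp add: N_def)
qed

theorem corollary2p4:
  fixes m :: nat and u :: "nat \<Rightarrow> complex" and z :: complex
  assumes u_0: "u 0 = 1"
    and u_1: "u 1 = - 4 * of_nat m ^ 2"
    and u_rec: "\<And>n. n \<ge> 1 \<Longrightarrow>
      u (n + 1) =
        (- 8 * of_nat m ^ 2 + 4 * of_nat n ^ 2 - 3 * of_nat n + 1)
          / ((2 * of_nat n + 1) * (of_nat n + 1)) * u n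
        - 2 * (of_nat n - 1) * (- 2 * of_nat m + of_nat n - 1) * (2 * of_nat m + of_nat n - 1)
          / (of_nat n * (of_nat n + 1) * (2 * of_nat n + 1)) * u (n - 1)"
    and z: "norm z < 1"
  shows "(poly (chebyshev_T m) (1 - 2 * z)) ^ 2 = (hypergeo_2F1 (- of_nat m) (of_nat m) (1 / 2) z) ^ 2
      \<and> (\<lambda>n. u n * z ^ n) sums (hypergeo_2F1 (- of_nat m) (of_nat m) (1 / 2) z) ^ 2"
proof
  let ?P = "\<lambda>n. poly (chebyshev_T n) (1 - 2 * z)"
  show "?P m ^ 2 = (hypergeo_2F1 (- of_nat m) (of_nat m) (1 / 2) z) ^ 2"
    by (simp add: hypergeo_2F1_eq_chebyshev_T)
  have u_Suc: "u (Suc n) = gauss_coeff (of_nat (2 * m)) (Suc n) / 2" for n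
  proof (induction n)
    case 0
    then show ?case
      using u_1 by (simp add: gauss_coeff_Suc power_mult_distrib)
  next
    case (Suc n)
    have "u (Suc (Suc n)) = 2 * (of_nat (Suc n) ^ 2 - of_nat (2 * m) ^ 2)
        / ((2 * of_nat (Suc n) + 1) * (of_nat (Suc n) + 1)) * u (Suc n)"
    proof (rule first_order_recurrence)
      fix n :: nat
      assume "n \<ge> 1"
      then show "u (n + 1) =
          (- 2 * of_nat (2 * m) ^ 2 + 4 * of_nat n ^ 2 - 3 * of_nat n + 1)
            / ((2 * of_nat n + 1) * (of_nat n + 1)) * u n
          - 2 * (of_nat n - 1) * (- of_nat (2 * m) + of_nat n - 1) * (of_nat (2 * m) + of_nat n - 1)
            / (of_nat n * (of_nat n + 1) * (2 * of_nat n + 1)) * u (n - 1)"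
        by (subst u_rec) (simp_all add: power_mult_distrib)
    qed simp
    then show ?case
      unfolding Suc.IH gauss_coeff_Suc[of _ "Suc n"] by simp
  qed
  have double: "?P (2 * m) = 2 * ?P m ^ 2 - 1"
    by (simp add: chebyshev_T_double)
  have "(\<lambda>n. gauss_coeff (of_nat (2 * m)) (Suc n) * z ^ Suc n) sums (?P (2 * m) - 1)"
    using gauss_coeff_sums_chebyshev_T[of "2 * m" z] by (subst sums_Suc_iff) simp
  then have "(\<lambda>n. gauss_coeff (of_nat (2 * m)) (Suc n) * z ^ Suc n / 2) sums ((?P (2 * m) - 1) / 2)"
    by (rule sums_divide)
  then have "(\<lambda>n. u (Suc n) * z ^ Suc n) sums (?P m ^ 2 - 1)"
    unfolding double by (simp add: u_Suc diff_divide_distrib)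
  then have "(\<lambda>n. u n * z ^ n) sums ?P m ^ 2"
    by (subst (asm) sums_Suc_iff) (simp add: u_0)
  then show "(\<lambda>n. u n * z ^ n) sums (hypergeo_2F1 (- of_nat m) (of_nat m) (1 / 2) z) ^ 2"
    by (simp add: hypergeo_2F1_eq_chebyshev_T)
qed

end
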